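(* Let $d>4$ and, with the constant $c_4>0$ fixed in the context, let $\beta_*=\beta_*(r)=\beta_c-c_4r^{-d/2}$. There exist $r_0$ and constants $0<a\le A$ (independent of $r$ and $x$) such that for all integers $r\ge r_0$ and all $x\in\mathbb T_r$, $$a\left(\frac1{\max(1,\|x\|_\infty)^{d-2}}+\frac1{r^{d/2}}\right)\le \tau^{\mathbb T_r}_{\beta_*}(0,x)\le A\left(\frac1{\max(1,\|x\|_\infty)^{d-2}}+\frac1{r^{d/2}}\right).$$ In particular, there is a constant $a>0$ such that $\tau^{\mathbb T_r}_{\beta}(0,x)\ge a\big(\max(1,\|x\|_\infty)^{-(d-2)}+r^{-d/2}\big)$ for all integers $r\ge r_0$, all $x\in\mathbb T_r$ and all $\beta\ge\beta_*$.
   Context: Ising model. For a finite graph $\mathcal G=(V,E)$ and $\beta>0$, the Ising expectation of a function $F$ of $\sigma\in\{-1,+1\}^V$ is $\langle F\rangle^{\mathcal G}_\beta=\frac{1}{Z}\sum_\sigma F(\sigma)\exp\big(\beta\sum_{xy\in E}\sigma_x\sigma_y\big)$ with $Z$ the normalising constant. For an integer $r\ge3$, $\Lambda_r=[-r/2,r/2)^d\cap\mathbb Z^d$ is the graph with nearest-neighbour edges, and $\mathbb T_r=(\mathbb Z/r\mathbb Z)^d$ is the discrete torus with nearest-neighbour edges. A point of $\mathbb T_r$ is identified with its representative in $\Lambda_r$; in particular $\|x\|_\infty$ and $\tau_\beta(0,x)$ for $x\in\mathbb T_r$ are evaluated at that representative. $\tau_\beta^{\mathcal G}(x,y)=\langle\sigma_x\sigma_y\rangle_\beta^{\mathcal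 G}$ for $\mathcal G=\Lambda_r,\mathbb T_r$; $\tau_\beta(x,y)=\lim_{r\to\infty}\tau_\beta^{\Lambda_r}(x,y)$; $\chi(\beta)=\sum_{x\in\mathbb Z^d}\tau_\beta(0,x)\in[0,\infty]$; $\beta_c=\sup\{\beta>0:\chi(\beta)<\infty\}$. Known inputs for $d>4$: $\chi(\beta)$ is bounded above and below by positive multiples of $(\beta_c-\beta)^{-1}$ for $\beta<\beta_c$; and there are positive constants $c_0,C_0$, which we fix, such that for all $\beta\le\beta_c$: $\tau_\beta(0,x)\le \frac{C_0}{\max(1,\|x\|_\infty)^{d-2}}e^{-c_0(\beta_c-\beta)^{1/2}\|x\|_\infty}$ for all $x\in\mathbb Z^d$, and $\tau_\beta(0,x)\ge\frac{c_0}{\max(1,\|x\|_\infty)^{d-2}}$ whenever $\|x\|_\infty\le c_0(\beta_c-\beta)^{-1/2}$. Constants $c_1,\dots,c_5$: these are fixed positive constants depending only on $d$, with $c_3=\frac49c_0^2$, for which the following holds (their existence is a theorem of the same paper): $\tau_\beta^{\mathbb T_r}(0,x)\le \tau_\beta(0,x)+c_1\chi(\beta)r^{-d}$ for all $r\ge3$, $\beta\in(0,\beta_c)$, $x\in\mathbb T_r$; and $\tau_\beta^{\mathbb T_r}(0,x)\ge \tau_\beta(0,x)+c_2\chi(\beta)r^{-d}$ for all $r\ge3$, $\beta\in[\beta_c-c_3r^{-2},\beta_c-c_4r^{-d/2}]$ and $x\in\mathbb T_r$ with $\|x\|_\infty\ge c_5$. *)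

theory Defs
  imports "HOL-Analysis.Analysis" "HOL-Number_Theory.Cong"
begin

text \<open>
  A finite simple graph is given by its vertex set \<open>V\<close> and its set \<open>E\<close> of two-element edges,
  so that each unordered edge contributes once to the energy.
\<close>

definition ising_configs :: "'v set \<Rightarrow> ('v \<Rightarrow> real) set"
  where "ising_configs V = (V \<rightarrow>\<^sub>E {-1, 1})"

text \<open>For an edge \<open>e = {x, y}\<close> the inner product below is \<open>\<sigma> x * \<sigma> y\<close>.\<close>

definition ising_weight :: "'v set set \<Rightarrow> real \<Rightarrow> ('v \<Rightarrow> real) \<Rightarrow> real"
  where "ising_weight E \<beta> \<sigma> = exp (\<beta> * (\<Sum>e\<in>E. \<Prod>v\<in>e. \<sigma> v))"

definition ising_expectation ::
    "'v set \<Rightarrow> 'v set set \<Rightarrow> real \<Rightarrow> (('v \<Rightarrow> real) \<Rightarrow> real) \<Rightarrow> real"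
  where "ising_expectation V E \<beta> F =
    (\<Sum>\<sigma>\<in>ising_configs V. F \<sigma> * ising_weight E \<beta> \<sigma>) /
    (\<Sum>\<sigma>\<in>ising_configs V. ising_weight E \<beta> \<sigma>)"

definition two_point :: "'v set \<Rightarrow> 'v set set \<Rightarrow> real \<Rightarrow> 'v \<Rightarrow> 'v \<Rightarrow> real"
  where "two_point V E \<beta> x y = ising_expectation V E \<beta> (\<lambda>\<sigma>. \<sigma> x * \<sigma> y)"

definition sup_norm :: "int ^ 'd \<Rightarrow> int"
  where "sup_norm x = Max (range (\<lambda>i. \<bar>x $ i\<bar>))"

definition nearest_neighbour :: "int ^ 'd \<Rightarrow> int ^ 'd \<Rightarrow> bool"
  where "nearest_neighbour x y \<longleftrightarrow> (\<Sum>i\<in>UNIV. \<bar>x $ i - y $ i\<bar>) = 1"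

definition lattice_box :: "nat \<Rightarrow> (int ^ 'd) set"
  where "lattice_box r = {x. \<forall>i. - (real r / 2) \<le> real_of_int (x $ i) \<and> real_of_int (x $ i) < real r / 2}"

definition box_edges :: "nat \<Rightarrow> (int ^ 'd) set set"
  where "box_edges r = {{x, y} | x y. x \<in> lattice_box r \<and> y \<in> lattice_box r \<and> nearest_neighbour x y}"

text \<open>
  The torus \<open>(\<int>/r\<int>)\<^sup>d\<close> has \<open>lattice_box r\<close> as its vertex set, each point being identified with its
  representative there. Two points are adjacent if the second is congruent modulo \<open>r\<close>,
  coordinatewise, to a lattice neighbour of the first. This is a simple graph for \<open>r \<ge> 3\<close>.
\<close>

definition torus_edges :: "nat \<Rightarrow> (int ^ 'd) set set"
  where "torus_edges r =
    {{x, y} | x y. x \<in> lattice_box r \<and> y \<in> lattice_box r \<and>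
       (\<exists>z. nearest_neighbour x z \<and> (\<forall>i. [z $ i = y $ i] (mod int r)))}"

definition tau_box :: "nat \<Rightarrow> real \<Rightarrow> int ^ 'd \<Rightarrow> int ^ 'd \<Rightarrow> real"
  where "tau_box r = two_point (lattice_box r) (box_edges r)"

definition tau_torus :: "nat \<Rightarrow> real \<Rightarrow> int ^ 'd \<Rightarrow> int ^ 'd \<Rightarrow> real"
  where "tau_torus r = two_point (lattice_box r) (torus_edges r)"

text \<open>For \<open>\<beta> > 0\<close> the limit exists by Griffiths' inequalities.\<close>

definition tau :: "real \<Rightarrow> int ^ 'd \<Rightarrow> int ^ 'd \<Rightarrow> real"
  where "tau \<beta> x y = lim (\<lambda>r. tau_box r \<beta> x y)"

definition chi :: "'d::finite itself \<Rightarrow> real \<Rightarrow> ennreal"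
  where "chi _ \<beta> = (\<Sum>\<^sub>\<infinity>x\<in>(UNIV :: (int ^ 'd) set). ennreal (tau \<beta> 0 x))"

text \<open>
  The supremum is taken in the extended reals, where it is meaningful without knowing that the set
  is nonempty and bounded.
\<close>

definition beta_crit :: "'d::finite itself \<Rightarrow> ereal"
  where "beta_crit _ = (SUP \<beta>\<in>{\<beta>. 0 < \<beta> \<and> chi TYPE('d) \<beta> < \<infinity>}. ereal \<beta>)"

end

theory Submission
  imports Defs
begin

text \<open>
  At \<open>\<beta>\<^sub>* = \<beta>\<^sub>c - c\<^sub>4 r\<^sup>-\<^sup>d\<^sup>/\<^sup>2\<close> the susceptibility has order \<open>r\<^sup>d\<^sup>/\<^sup>2\<close>, so the plateau term
  \<open>\<chi> r\<^sup>-\<^sup>d\<close> of the torus estimates has order \<open>r\<^sup>-\<^sup>d\<^sup>/\<^sup>2\<close>; since \<open>d > 4\<close>, the torus lies inside the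
  correlation length, where the infinite-volume function has order \<open>\<parallel>x\<parallel>\<^sup>2\<^sup>-\<^sup>d\<close>. The finitely many
  points with \<open>\<parallel>x\<parallel> < c\<^sub>5\<close>, to which the torus lower bound does not apply, are handled by Griffiths'
  monotonicity: for a fixed \<open>\<beta>\<^sub>1 < \<beta>\<^sub>c\<close>, the torus function at \<open>\<beta>\<^sub>*\<close> dominates the box function at
  \<open>\<beta>\<^sub>1\<close>, which converges to the infinite-volume one. Monotonicity in \<open>\<beta>\<close> also gives the bound for
  all \<open>\<beta> \<ge> \<beta>\<^sub>*\<close>.
\<close>

section \<open>Griffiths' inequalities\<close>

text \<open>Arbitrary exponents make closure under products a matter of adding them. The identity is
  asked for on configurations only, where all sums are evaluated.\<close>

definition spin_monomial :: "'v set \<Rightarrow> (('v \<Rightarrow> real) \<Rightarrow> real) \<Rightarrow> bool"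
  where "spin_monomial V f \<longleftrightarrow>
    (\<exists>n :: 'v \<Rightarrow> nat. \<forall>\<sigma>\<in>ising_configs V. f \<sigma> = (\<Prod>v\<in>V. \<sigma> v ^ n v))"

lemma finite_ising_configs: "finite V \<Longrightarrow> finite (ising_configs V)"
  unfolding ising_configs_def by (intro finite_PiE) auto

lemma ising_configs_nonempty: "ising_configs V \<noteq> {}"
  unfolding ising_configs_def by (simp add: PiE_eq_empty_iff)

lemma spin_square: "\<sigma> \<in> ising_configs V \<Longrightarrow> v \<in> V \<Longrightarrow> \<sigma> v * \<sigma> v = 1"
  unfolding ising_configs_def by (auto simp: PiE_iff)

lemma spin_monomial_mult:
  assumes "spin_monomial V f" "spin_monomial V g"
  shows "spin_monomial V (\<lambda>\<sigma>. f \<sigma> * g \<sigma>)"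
proof -
  obtain m n where "\<forall>\<sigma>\<in>ising_configs V. f \<sigma> = (\<Prod>v\<in>V. \<sigma> v ^ m v)"
    "\<forall>\<sigma>\<in>ising_configs V. g \<sigma> = (\<Prod>v\<in>V. \<sigma> v ^ n v)"
    using assms unfolding spin_monomial_def by blast
  then show ?thesis
    unfolding spin_monomial_def
    by (intro exI[of _ "\<lambda>v. m v + n v"]) (simp add: power_add prod.distrib)
qed

lemma spin_monomial_prod:
  assumes "finite V" "A \<subseteq> V"
  shows "spin_monomial V (\<lambda>\<sigma>. \<Prod>v\<in>A. \<sigma> v)"
proof -
  have "(\<Prod>v\<in>V. \<sigma> v ^ of_bool (v \<in> A)) = (\<Prod>v\<in>A. \<sigma> v)" for \<sigma> :: "'a \<Rightarrow> real"
    by (rule prod.mono_neutral_cong_right) (use assms in auto)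
  then show ?thesis
    unfolding spin_monomial_def by (intro exI[of _ "\<lambda>v. of_bool (v \<in> A)"]) simp
qed

lemma spin_monomial_spin:
  assumes "finite V" "x \<in> V"
  shows "spin_monomial V (\<lambda>\<sigma>. \<sigma> x)"
  using spin_monomial_prod[of V "{x}"] assms by simp

lemma spin_monomial_square:
  assumes "spin_monomial V f" "\<sigma> \<in> ising_configs V"
  shows "f \<sigma> * f \<sigma> = 1"
proof -
  obtain n where "f \<sigma> = (\<Prod>v\<in>V. \<sigma> v ^ n v)"
    using assms unfolding spin_monomial_def by blast
  then have "f \<sigma> * f \<sigma> = (\<Prod>v\<in>V. (\<sigma> v * \<sigma> v) ^ n v)"
    by (simp add: prod.distrib power_mult_distrib)
  then show ?thesis
    using spin_square[OF assms(2)] by simp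
qed

text \<open>A monomial takes only the values 1 and -1, so its Boltzmann factor is affine in it. This
  replaces power series and derivatives throughout.\<close>

lemma spin_monomial_exp:
  assumes "spin_monomial V f" "\<sigma> \<in> ising_configs V"
  shows "exp (J * f \<sigma>) = cosh J + f \<sigma> * sinh J"
proof -
  have "f \<sigma> = 1 \<or> f \<sigma> = -1"
    using spin_monomial_square[OF assms] by (simp add: square_eq_1_iff)
  then show ?thesis
    by (auto simp: cosh_plus_sinh cosh_minus_sinh)
qed

text \<open>The sum factorises over the vertices, and each factor \<open>(-1) ^ n v + 1\<close> is 0
  or 2.\<close>

lemma sum_spin_monomial_nonneg:
  assumes "finite V" "spin_monomial V f"
  shows "0 \<le> (\<Sum>\<sigma>\<in>ising_configs V. f \<sigma>)"
proof -
  obtain n where "\<forall>\<sigma>\<in>ising_configs V. f \<sigma> = (\<Prod>v\<in>V. \<sigma> v ^ n v)"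
    using assms unfolding spin_monomial_def by blast
  then have "(\<Sum>\<sigma>\<in>ising_configs V. f \<sigma>) = (\<Sum>\<sigma>\<in>ising_configs V. \<Prod>v\<in>V. \<sigma> v ^ n v)"
    by simp
  also have "\<dots> = (\<Prod>v\<in>V. \<Sum>s\<in>{-1, 1}. s ^ n v)"
    unfolding ising_configs_def by (rule prod_sum_PiE[symmetric]) (use assms(1) in auto)
  finally have "(\<Sum>\<sigma>\<in>ising_configs V. f \<sigma>) = (\<Prod>v\<in>V. \<Sum>s\<in>{-1, 1}. s ^ n v)" .
  moreover have "0 \<le> (\<Sum>s\<in>{-1, 1 :: real}. s ^ k)" for k
    by (cases "even k") auto
  ultimately show ?thesis
    by (simp add: prod_nonneg)
qed

text \<open>Each monomial has its own coupling: the duplicated system produces unequal couplings,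
  and the monotonicity proof raises them one at a time.\<close>

definition gibbs_weight ::
    "'i set \<Rightarrow> ('i \<Rightarrow> ('v \<Rightarrow> real) \<Rightarrow> real) \<Rightarrow> ('i \<Rightarrow> real) \<Rightarrow> ('v \<Rightarrow> real) \<Rightarrow> real"
  where "gibbs_weight I g J \<sigma> = exp (\<Sum>i\<in>I. J i * g i \<sigma>)"

text \<open>Peeling off the coupling \<open>J i\<close> leaves the sums for \<open>f\<close> and for
  \<open>f * g i\<close>, with coefficients \<open>cosh (J i)\<close> and \<open>sinh (J i)\<close>,
  both nonnegative. The induction therefore has to run over all monomials \<open>f\<close>.\<close>

theorem griffiths_first:
  assumes "finite V" "finite I" "\<And>i. i \<in> I \<Longrightarrow> spin_monomial V (g i)"
    and "\<And>i. i \<in> I \<Longrightarrow> 0 \<le> J i" "spin_monomial V f"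
  shows "0 \<le> (\<Sum>\<sigma>\<in>ising_configs V. f \<sigma> * gibbs_weight I g J \<sigma>)"
  using assms(2-5)
proof (induction I arbitrary: f rule: finite_induct)
  case empty
  then show ?case
    using sum_spin_monomial_nonneg[OF assms(1)] by (simp add: gibbs_weight_def)
next
  case (insert i I)
  have g: "spin_monomial V (g i)" and J: "0 \<le> J i"
    using insert.prems by auto
  have "(\<Sum>\<sigma>\<in>ising_configs V. f \<sigma> * gibbs_weight (insert i I) g J \<sigma>) =
      (\<Sum>\<sigma>\<in>ising_configs V. cosh (J i) * (f \<sigma> * gibbs_weight I g J \<sigma>)
        + sinh (J i) * ((f \<sigma> * g i \<sigma>) * gibbs_weight I g J \<sigma>))"
    using insert.hyps spin_monomial_exp[OF g]
    by (intro sum.cong) (auto simp: gibbs_weight_def exp_add algebra_simps)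
  also have "\<dots> = cosh (J i) * (\<Sum>\<sigma>\<in>ising_configs V. f \<sigma> * gibbs_weight I g J \<sigma>)
      + sinh (J i) * (\<Sum>\<sigma>\<in>ising_configs V. (f \<sigma> * g i \<sigma>) * gibbs_weight I g J \<sigma>)"
    by (simp add: sum.distrib sum_distrib_left)
  also have "\<dots> \<ge> 0"
    using insert.IH[of f] insert.IH[of "\<lambda>\<sigma>. f \<sigma> * g i \<sigma>"] insert.prems J
      spin_monomial_mult[OF insert.prems(3) g]
    by (intro add_nonneg_nonneg mult_nonneg_nonneg) (auto simp: cosh_real_nonneg)
  finally show ?case .
qed

text \<open>The group operation of the configuration space; the restriction to \<open>V\<close>
  keeps the product extensional.\<close>

definition spin_mult :: "'v set \<Rightarrow> ('v \<Rightarrow> real) \<Rightarrow> ('v \<Rightarrow> real) \<Rightarrow> 'v \<Rightarrow> real"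
  where "spin_mult V \<sigma> t = (\<lambda>v\<in>V. \<sigma> v * t v)"

lemma spin_mult_in_configs:
  assumes "\<sigma> \<in> ising_configs V" "t \<in> ising_configs V"
  shows "spin_mult V \<sigma> t \<in> ising_configs V"
  unfolding ising_configs_def
proof (rule PiE_I)
  fix v assume "v \<in> V"
  then have "\<sigma> v \<in> {-1, 1}" "t v \<in> {-1, 1}"
    using assms unfolding ising_configs_def by (auto dest: PiE_mem)
  then show "spin_mult V \<sigma> t v \<in> {-1, 1}"
    using \<open>v \<in> V\<close> by (auto simp: spin_mult_def)
qed (simp add: spin_mult_def)

text \<open>Every configuration is its own inverse, so multiplication by \<sigma> is a bijective
  change of variables.\<close>

lemma spin_mult_involution:
  assumes "\<sigma> \<in> ising_configs V" "t \<in> ising_configs V"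
  shows "spin_mult V \<sigma> (spin_mult V \<sigma> t) = t"
proof
  fix v
  show "spin_mult V \<sigma> (spin_mult V \<sigma> t) v = t v"
  proof (cases "v \<in> V")
    case True
    then show ?thesis
      using spin_square[OF assms(1) True] by (simp add: spin_mult_def flip: mult.assoc)
  next
    case False
    then show ?thesis
      using assms(2) by (auto simp: spin_mult_def ising_configs_def PiE_def extensional_def)
  qed
qed

text \<open>Monomials are the characters of this group.\<close>

lemma spin_monomial_spin_mult:
  assumes "spin_monomial V f" "\<sigma> \<in> ising_configs V" "t \<in> ising_configs V"
  shows "f (spin_mult V \<sigma> t) = f \<sigma> * f t"
proof -
  obtain n where "\<forall>\<sigma>\<in>ising_configs V. f \<sigma> = (\<Prod>v\<in>V. \<sigma> v ^ n v)"
    using assms unfolding spin_monomial_def by blast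
  then show ?thesis
    using assms(2,3) spin_mult_in_configs[OF assms(2,3)]
    by (simp add: prod.distrib[symmetric] power_mult_distrib[symmetric] spin_mult_def)
qed

text \<open>
  Ginibre's argument: in the duplicated system, substitute \<open>\<tau> = \<sigma> t\<close>; for fixed \<open>t\<close> the sum over
  \<open>\<sigma>\<close> is an expectation with the nonnegative couplings \<open>J i * (1 + g i t)\<close>.
\<close>

theorem griffiths_second:
  assumes V: "finite V" and I: "finite I" and g: "\<And>i. i \<in> I \<Longrightarrow> spin_monomial V (g i)"
    and J: "\<And>i. i \<in> I \<Longrightarrow> 0 \<le> J i" and f: "spin_monomial V f" and h: "spin_monomial V h"
  shows "(\<Sum>\<sigma>\<in>ising_configs V. f \<sigma> * gibbs_weight I g J \<sigma>) *
      (\<Sum>\<sigma>\<in>ising_configs V. h \<sigma> * gibbs_weight I g J \<sigma>)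
    \<le> (\<Sum>\<sigma>\<in>ising_configs V. f \<sigma> * h \<sigma> * gibbs_weight I g J \<sigma>) *
      (\<Sum>\<sigma>\<in>ising_configs V. gibbs_weight I g J \<sigma>)"
proof -
  let ?C = "ising_configs V" and ?w = "gibbs_weight I g J"
  let ?D = "\<lambda>\<sigma> \<tau>. f \<sigma> * (h \<sigma> - h \<tau>) * (?w \<sigma> * ?w \<tau>)"
  \<comment> \<open>As monomials are multiplicative, \<open>h\<close> contributes the factor
    \<open>1 - h t\<close>, and the two energies add up to
    \<open>J i * (1 + g i t) * g i \<sigma>\<close> for each \<open>i\<close>.\<close>
  have substituted: "?D \<sigma> (spin_mult V \<sigma> t) =
      (1 - h t) * (f \<sigma> * h \<sigma> * gibbs_weight I g (\<lambda>i. J i * (1 + g i t)) \<sigma>)"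
    if "\<sigma> \<in> ?C" "t \<in> ?C" for \<sigma> t
  proof -
    have "?w \<sigma> * ?w (spin_mult V \<sigma> t) = gibbs_weight I g (\<lambda>i. J i * (1 + g i t)) \<sigma>"
      using spin_monomial_spin_mult[OF g that]
      by (simp add: gibbs_weight_def algebra_simps sum.distrib flip: exp_add)
    then show ?thesis
      using spin_monomial_spin_mult[OF h that] by (simp add: algebra_simps)
  qed
  \<comment> \<open>The difference of the two sides is written as one double sum over the duplicated
    system.\<close>
  have "(\<Sum>\<sigma>\<in>?C. f \<sigma> * h \<sigma> * ?w \<sigma>) * (\<Sum>\<sigma>\<in>?C. ?w \<sigma>)
      - (\<Sum>\<sigma>\<in>?C. f \<sigma> * ?w \<sigma>) * (\<Sum>\<sigma>\<in>?C. h \<sigma> * ?w \<sigma>) = (\<Sum>\<sigma>\<in>?C. \<Sum>\<tau>\<in>?C. ?D \<sigma> \<tau>)"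
    unfolding sum_product sum_subtractf[symmetric] by (simp add: algebra_simps)
  also have "\<dots> = (\<Sum>\<sigma>\<in>?C. \<Sum>t\<in>?C. ?D \<sigma> (spin_mult V \<sigma> t))"
  proof (rule sum.cong[OF refl])
    fix \<sigma> assume "\<sigma> \<in> ?C"
    then have "bij_betw (spin_mult V \<sigma>) ?C ?C"
      by (intro bij_betw_byWitness[where f' = "spin_mult V \<sigma>"])
        (auto simp: spin_mult_involution spin_mult_in_configs)
    then show "(\<Sum>\<tau>\<in>?C. ?D \<sigma> \<tau>) = (\<Sum>t\<in>?C. ?D \<sigma> (spin_mult V \<sigma> t))"
      by (rule sum.reindex_bij_betw[symmetric])
  qed
  also have "\<dots> = (\<Sum>t\<in>?C. (1 - h t) *
      (\<Sum>\<sigma>\<in>?C. f \<sigma> * h \<sigma> * gibbs_weight I g (\<lambda>i. J i * (1 + g i t)) \<sigma>))"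
    unfolding sum_distrib_left by (subst sum.swap) (intro sum.cong refl substituted)
  also have "\<dots> \<ge> 0"
  proof (rule sum_nonneg, rule mult_nonneg_nonneg)
    fix t assume t: "t \<in> ?C"
    have abs: "\<bar>k t\<bar> \<le> 1" if "spin_monomial V k" for k
      using spin_monomial_square[OF that t] by (auto simp: square_eq_1_iff)
    show "0 \<le> 1 - h t"
      using abs[OF h] by simp
    have "0 \<le> J i * (1 + g i t)" if "i \<in> I" for i
      using abs[OF g[OF that]] J[OF that] by (intro mult_nonneg_nonneg) auto
    then show "0 \<le> (\<Sum>\<sigma>\<in>?C. f \<sigma> * h \<sigma> * gibbs_weight I g (\<lambda>i. J i * (1 + g i t)) \<sigma>)"
      by (intro griffiths_first[where f = "\<lambda>\<sigma>. f \<sigma> * h \<sigma>"] V I g spin_monomial_mult f h)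
  qed
  finally show ?thesis by simp
qed

section \<open>Monotonicity in the couplings\<close>

definition gibbs_expectation ::
    "'v set \<Rightarrow> 'i set \<Rightarrow> ('i \<Rightarrow> ('v \<Rightarrow> real) \<Rightarrow> real) \<Rightarrow> ('i \<Rightarrow> real) \<Rightarrow> (('v \<Rightarrow> real) \<Rightarrow> real) \<Rightarrow> real"
  where "gibbs_expectation V I g J f =
    (\<Sum>\<sigma>\<in>ising_configs V. f \<sigma> * gibbs_weight I g J \<sigma>) /
    (\<Sum>\<sigma>\<in>ising_configs V. gibbs_weight I g J \<sigma>)"

lemma partition_function_pos:
  "finite V \<Longrightarrow> 0 < (\<Sum>\<sigma>\<in>ising_configs V. gibbs_weight I g J \<sigma>)"
  by (intro sum_pos) (auto simp: finite_ising_configs ising_configs_nonempty gibbs_weight_def)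

text \<open>
  Raising one coupling by \<open>\<delta>\<close> multiplies the weight by \<open>cosh \<delta> + g i \<sigma> * sinh \<delta>\<close>, so no
  differentiation in the coupling is needed.
\<close>

lemma gibbs_expectation_raise_coupling:
  assumes V: "finite V" and I: "finite I" and g: "\<And>i. i \<in> I \<Longrightarrow> spin_monomial V (g i)"
    and J: "\<And>i. i \<in> I \<Longrightarrow> 0 \<le> J i" and f: "spin_monomial V f"
    and i: "i \<in> I" and le: "J i \<le> b"
  shows "gibbs_expectation V I g J f \<le> gibbs_expectation V I g (J(i := b)) f"
proof -
  let ?C = "ising_configs V" and ?w = "gibbs_weight I g J" and ?w' = "gibbs_weight I g (J(i := b))"
  define \<delta> where "\<delta> = b - J i"
  have \<delta>: "0 \<le> \<delta>" using le by (simp add: \<delta>_def)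
  have w': "?w' \<sigma> = ?w \<sigma> * (cosh \<delta> + g i \<sigma> * sinh \<delta>)" if "\<sigma> \<in> ?C" for \<sigma>
  proof -
    have "(\<Sum>k\<in>I. (J(i := b)) k * g k \<sigma>) = (\<Sum>k\<in>I. J k * g k \<sigma>) + \<delta> * g i \<sigma>"
      using I i by (simp add: sum.remove[of I i] \<delta>_def algebra_simps)
    then show ?thesis
      using spin_monomial_exp[OF g[OF i] that, of \<delta>] by (simp add: gibbs_weight_def exp_add)
  qed
  define Z F G H where "Z = (\<Sum>\<sigma>\<in>?C. ?w \<sigma>)" and "F = (\<Sum>\<sigma>\<in>?C. f \<sigma> * ?w \<sigma>)"
    and "G = (\<Sum>\<sigma>\<in>?C. g i \<sigma> * ?w \<sigma>)" and "H = (\<Sum>\<sigma>\<in>?C. f \<sigma> * g i \<sigma> * ?w \<sigma>)"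
  have Z': "(\<Sum>\<sigma>\<in>?C. ?w' \<sigma>) = cosh \<delta> * Z + sinh \<delta> * G"
    by (simp add: w' Z_def G_def sum_distrib_left algebra_simps sum.distrib)
  have F': "(\<Sum>\<sigma>\<in>?C. f \<sigma> * ?w' \<sigma>) = cosh \<delta> * F + sinh \<delta> * H"
    by (simp add: w' F_def H_def sum_distrib_left algebra_simps sum.distrib)
  \<comment> \<open>Multiplied by \<open>sinh \<delta>\<close>, this is the cross-multiplied claim:
    the terms \<open>cosh \<delta> * F * Z\<close> cancel.\<close>
  have "F * G \<le> H * Z"
    using griffiths_second[OF V I g J f g[OF i]] by (simp add: F_def G_def H_def Z_def)
  then have "F * (cosh \<delta> * Z + sinh \<delta> * G) \<le> (cosh \<delta> * F + sinh \<delta> * H) * Z"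
    using mult_left_mono[of "F * G" "H * Z" "sinh \<delta>"] \<delta> by (simp add: algebra_simps)
  moreover have "0 < Z" "0 < cosh \<delta> * Z + sinh \<delta> * G"
    using partition_function_pos[OF V] unfolding Z_def Z'[unfolded Z_def, symmetric] by auto
  ultimately have "F / Z \<le> (cosh \<delta> * F + sinh \<delta> * H) / (cosh \<delta> * Z + sinh \<delta> * G)"
    by (simp add: divide_simps mult.commute)
  then show ?thesis
    unfolding gibbs_expectation_def Z' F' by (simp add: F_def Z_def)
qed

theorem gibbs_expectation_mono:
  assumes V: "finite V" and I: "finite I" and g: "\<And>i. i \<in> I \<Longrightarrow> spin_monomial V (g i)"
    and f: "spin_monomial V f"
    and J: "\<And>i. i \<in> I \<Longrightarrow> 0 \<le> J i" and J': "\<And>i. i \<in> I \<Longrightarrow> J i \<le> J' i"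
  shows "gibbs_expectation V I g J f \<le> gibbs_expectation V I g J' f"
proof -
  \<comment> \<open>\<open>K S\<close> interpolates between \<open>J\<close> and \<open>J'\<close>;
    adding one index to \<open>S\<close> raises one coupling.\<close>
  define K where "K S i = (if i \<in> S then J' i else J i)" for S i
  have "gibbs_expectation V I g J f \<le> gibbs_expectation V I g (K S) f" if "S \<subseteq> I" for S
    using finite_subset[OF that I] that
  proof (induction S rule: finite_induct)
    case empty
    then show ?case by (simp add: K_def)
  next
    case (insert i S)
    have i: "i \<in> I" and S: "S \<subseteq> I"
      using insert.prems by auto
    have "K S i \<le> J' i"
      using i J' by (auto simp: K_def)
    moreover have "0 \<le> K S k" if "k \<in> I" for k
      using J[OF that] J'[OF that] by (auto simp: K_def)
    ultimately have "gibbs_expectation V I g (K S) f \<le> gibbs_expectation V I g ((K S)(i := J' i)) f"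
      by (intro gibbs_expectation_raise_coupling V I g f i)
    moreover have "(K S)(i := J' i) = K (insert i S)"
      by (auto simp: K_def)
    ultimately show ?case
      using insert.IH[OF S] by simp
  qed
  \<comment> \<open>\<open>K I\<close> agrees with \<open>J'\<close> on \<open>I\<close> only, but
    the weight sees no other index.\<close>
  from this[of I] show ?thesis
    by (simp add: K_def gibbs_expectation_def gibbs_weight_def cong: sum.cong)
qed

text \<open>Absent edges become edges of coupling 0, so that two nested graphs are compared over one
  index set.\<close>

lemma two_point_eq_gibbs_expectation:
  assumes "finite E'" "E \<subseteq> E'"
  shows "two_point V E \<beta> x y = gibbs_expectation V E' (\<lambda>e \<sigma>. \<Prod>v\<in>e. \<sigma> v)
    (\<lambda>e. if e \<in> E then \<beta> else 0) (\<lambda>\<sigma>. \<sigma> x * \<sigma> y)"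
proof -
  have "ising_weight E \<beta> = gibbs_weight E' (\<lambda>e \<sigma>. \<Prod>v\<in>e. \<sigma> v) (\<lambda>e. if e \<in> E then \<beta> else 0)"
    using assms by (simp add: fun_eq_iff ising_weight_def gibbs_weight_def sum_distrib_left
        if_distrib[of "\<lambda>c. c * _"] sum.inter_restrict[symmetric] Int_absorb1 cong: if_cong)
  then show ?thesis
    by (simp add: two_point_def ising_expectation_def gibbs_expectation_def)
qed

text \<open>Each edge of \<open>E'\<close> has its coupling raised from \<beta> or 0 to
  \<open>\<beta>'\<close>. This covers larger \<beta>, added box edges and the passage from box to
  torus.\<close>

theorem two_point_mono:
  assumes "finite V" "E' \<subseteq> Pow V" "E \<subseteq> E'" "x \<in> V" "y \<in> V" "0 \<le> \<beta>" "\<beta> \<le> \<beta>'"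
  shows "two_point V E \<beta> x y \<le> two_point V E' \<beta>' x y"
proof -
  have "finite E'"
    using assms(1,2) by (meson finite_Pow_iff finite_subset)
  then show ?thesis
    using assms two_point_eq_gibbs_expectation[of E' E V \<beta> x y]
      two_point_eq_gibbs_expectation[of E' E' V \<beta>' x y]
    by (auto intro!: gibbs_expectation_mono spin_monomial_mult spin_monomial_spin spin_monomial_prod)
qed

lemma sum_ising_configs_insert:
  assumes "a \<notin> V"
    and "\<And>\<sigma> s. \<sigma> \<in> ising_configs V \<Longrightarrow> F (\<sigma>(a := s)) = F \<sigma>"
  shows "(\<Sum>\<sigma>\<in>ising_configs (insert a V). F \<sigma>) = 2 * (\<Sum>\<sigma>\<in>ising_configs V. F \<sigma> :: real)"
proof -
  have "(\<Sum>\<sigma>\<in>ising_configs (insert a V). F \<sigma>)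
      = (\<Sum>(s, \<sigma>)\<in>{-1, 1} \<times> ising_configs V. F (\<sigma>(a := s)))"
    unfolding ising_configs_def PiE_insert_eq
    by (subst sum.reindex[OF inj_combinator[OF assms(1)]]) (simp add: case_prod_unfold)
  also have "\<dots> = (\<Sum>s\<in>{-1, 1 :: real}. \<Sum>\<sigma>\<in>ising_configs V. F \<sigma>)"
    by (simp add: sum.cartesian_product[symmetric] assms(2))
  finally show ?thesis by simp
qed

text \<open>Each isolated vertex doubles numerator and denominator alike. This allows boxes of
  different sizes to be compared on a common vertex set.\<close>

lemma two_point_isolated_vertices:
  assumes "finite V'" "V \<subseteq> V'" "E \<subseteq> Pow V" "x \<in> V" "y \<in> V"
  shows "two_point V' E \<beta> x y = two_point V E \<beta> x y"
proof -
  have "two_point (V \<union> B) E \<beta> x y = two_point V E \<beta> x y" if "finite B" "B \<inter> V = {}" for B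
    using that
  proof (induction B rule: finite_induct)
    case empty
    then show ?case by simp
  next
    case (insert a B)
    have a: "a \<notin> V \<union> B" using insert by auto
    have weight: "ising_weight E \<beta> (\<sigma>(a := s)) = ising_weight E \<beta> \<sigma>" for \<sigma> s
    proof -
      have "(\<Prod>v\<in>e. (\<sigma>(a := s)) v) = (\<Prod>v\<in>e. \<sigma> v)" if "e \<in> E" for e
        using that assms(3) a by (intro prod.cong) auto
      then show ?thesis by (simp add: ising_weight_def)
    qed
    have "two_point (insert a (V \<union> B)) E \<beta> x y = two_point (V \<union> B) E \<beta> x y"
      using a assms(4,5) weight
      unfolding two_point_def ising_expectation_def
      by (subst (1 2) sum_ising_configs_insert) auto
    then show ?case using insert by simp
  qed
  moreover have "V \<union> (V' - V) = V'" "(V' - V) \<inter> V = {}" "finite (V' - V)"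
    using assms(1,2) by auto
  ultimately show ?thesis by metis
qed

text \<open>Spin products have modulus 1 and weights are positive. The bound makes the increasing
  box functions converge.\<close>

lemma abs_two_point_le_1:
  assumes "finite V" "x \<in> V" "y \<in> V"
  shows "\<bar>two_point V E \<beta> x y\<bar> \<le> 1"
proof -
  have "\<bar>\<Sum>\<sigma>\<in>ising_configs V. \<sigma> x * \<sigma> y * ising_weight E \<beta> \<sigma>\<bar>
      \<le> (\<Sum>\<sigma>\<in>ising_configs V. \<bar>\<sigma> x * \<sigma> y * ising_weight E \<beta> \<sigma>\<bar>)"
    by (rule sum_abs)
  also have "\<dots> = (\<Sum>\<sigma>\<in>ising_configs V. ising_weight E \<beta> \<sigma>)"
  proof (rule sum.cong[OF refl])
    fix \<sigma> assume "\<sigma> \<in> ising_configs V"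
    then have "\<bar>\<sigma> x\<bar> = 1" "\<bar>\<sigma> y\<bar> = 1"
      using assms by (auto simp: ising_configs_def PiE_iff)
    then show "\<bar>\<sigma> x * \<sigma> y * ising_weight E \<beta> \<sigma>\<bar> = ising_weight E \<beta> \<sigma>"
      by (simp add: abs_mult ising_weight_def)
  qed
  moreover have "0 < (\<Sum>\<sigma>\<in>ising_configs V. ising_weight E \<beta> \<sigma>)"
    using assms(1) finite_ising_configs ising_configs_nonempty
    by (intro sum_pos) (auto simp: ising_weight_def)
  ultimately show ?thesis
    by (simp add: two_point_def ising_expectation_def abs_divide)
qed

section \<open>Boxes and tori\<close>

lemma finite_lattice_box: "finite (lattice_box r :: (int ^ 'd::finite) set)"
proof -
  have "x \<in> vec_lambda ` (UNIV \<rightarrow>\<^sub>E {- int r..int r})" if "x \<in> lattice_box r" for x :: "int ^ 'd"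
  proof (rule image_eqI[of _ _ "vec_nth x"])
    have "x $ i \<in> {- int r..int r}" for i
    proof -
      have "- (real r / 2) \<le> real_of_int (x $ i)" "real_of_int (x $ i) < real r / 2"
        using that unfolding lattice_box_def by auto
      then have "real_of_int (- int r) \<le> real_of_int (x $ i)" "real_of_int (x $ i) \<le> real_of_int (int r)"
        by auto
      then show ?thesis
        unfolding of_int_le_iff by simp
    qed
    then show "vec_nth x \<in> UNIV \<rightarrow>\<^sub>E {- int r..int r}" by auto
  qed simp
  then have "lattice_box r \<subseteq> vec_lambda ` (UNIV \<rightarrow>\<^sub>E {- int r..int r} :: ('d \<Rightarrow> int) set)"
    by blast
  then show ?thesis
    by (rule finite_subset) (intro finite_imageI finite_PiE; simp)
qed

lemma lattice_box_mono: "r \<le> s \<Longrightarrow> lattice_box r \<subseteq> (lattice_box s :: (int ^ 'd::finite) set)"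
proof (clarsimp simp: lattice_box_def)
  fix x :: "int ^ 'd" and i
  assume "r \<le> s" "\<forall>i. - (real r / 2) \<le> real_of_int (x $ i) \<and> real_of_int (x $ i) * 2 < real r"
  then have "real r \<le> real s" "- (real r / 2) \<le> real_of_int (x $ i)" "real_of_int (x $ i) * 2 < real r"
    by auto
  then show "- (real s / 2) \<le> real_of_int (x $ i) \<and> real_of_int (x $ i) * 2 < real s"
    by linarith
qed

lemma zero_in_lattice_box: "0 < r \<Longrightarrow> (0 :: int ^ 'd::finite) \<in> lattice_box r"
  by (simp add: lattice_box_def)

lemma abs_le_sup_norm: "\<bar>x $ i\<bar> \<le> sup_norm (x :: int ^ 'd::finite)"
  unfolding sup_norm_def by (rule Max_ge) auto

lemma sup_norm_nonneg: "0 \<le> sup_norm (x :: int ^ 'd::finite)"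
  using abs_le_sup_norm[of x undefined] by linarith

text \<open>Equality can occur: the box is half-open, and for even \<open>r\<close> the coordinate
  \<open>- r / 2\<close> belongs to it.\<close>

lemma sup_norm_lattice_box:
  assumes "(x :: int ^ 'd::finite) \<in> lattice_box r"
  shows "real_of_int (sup_norm x) \<le> real r / 2"
proof -
  have "sup_norm x \<in> range (\<lambda>i. \<bar>x $ i\<bar>)"
    unfolding sup_norm_def by (rule Max_in) auto
  then obtain i where "sup_norm x = \<bar>x $ i\<bar>" by blast
  moreover have "- (real r / 2) \<le> real_of_int (x $ i)" "real_of_int (x $ i) < real r / 2"
    using assms unfolding lattice_box_def by auto
  ultimately show ?thesis by simp
qed

lemma sup_norm_less_in_lattice_box:
  assumes "real_of_int (sup_norm x) < real r / 2"
  shows "(x :: int ^ 'd::finite) \<in> lattice_box r"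
  unfolding lattice_box_def
proof (clarify)
  fix i
  show "- (real r / 2) \<le> real_of_int (x $ i) \<and> real_of_int (x $ i) < real r / 2"
    using abs_le_sup_norm[of x i] assms by linarith
qed

lemma box_edges_subset_Pow: "box_edges r \<subseteq> Pow (lattice_box r)"
  unfolding box_edges_def by auto

lemma torus_edges_subset_Pow: "torus_edges r \<subseteq> Pow (lattice_box r)"
  unfolding torus_edges_def by auto

text \<open>The lattice neighbour required on the torus can be the second endpoint itself.\<close>

lemma box_edges_subset_torus_edges: "box_edges r \<subseteq> torus_edges r"
  unfolding box_edges_def torus_edges_def using cong_refl by blast

lemma box_edges_mono: "r \<le> s \<Longrightarrow> box_edges r \<subseteq> (box_edges s :: (int ^ 'd::finite) set set)"
  unfolding box_edges_def using lattice_box_mono by blast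

section \<open>Comparison of boxes and tori, and the infinite-volume limit\<close>

lemma tau_torus_mono:
  assumes "x \<in> lattice_box r" "y \<in> lattice_box r" "0 \<le> \<beta>" "\<beta> \<le> \<beta>'"
  shows "tau_torus r \<beta> x y \<le> tau_torus r \<beta>' x (y :: int ^ 'd::finite)"
  unfolding tau_torus_def
  using assms by (intro two_point_mono finite_lattice_box torus_edges_subset_Pow) auto

lemma tau_box_le_tau_torus:
  assumes "x \<in> lattice_box r" "y \<in> lattice_box r" "0 \<le> \<beta>" "\<beta> \<le> \<beta>'"
  shows "tau_box r \<beta> x y \<le> tau_torus r \<beta>' x (y :: int ^ 'd::finite)"
  unfolding tau_box_def tau_torus_def
  using assms by (intro two_point_mono finite_lattice_box torus_edges_subset_Pow
      box_edges_subset_torus_edges) auto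

text \<open>First the new vertices are added without edges, which changes nothing; then the new
  edges are added.\<close>

lemma tau_box_mono:
  assumes "x \<in> lattice_box r" "y \<in> lattice_box r" "0 \<le> \<beta>" "r \<le> s"
  shows "tau_box r \<beta> x y \<le> tau_box s \<beta> x (y :: int ^ 'd::finite)"
proof -
  have "tau_box r \<beta> x y = two_point (lattice_box s) (box_edges r) \<beta> x y"
    unfolding tau_box_def using assms lattice_box_mono
    by (intro two_point_isolated_vertices[symmetric] finite_lattice_box box_edges_subset_Pow) auto
  also have "\<dots> \<le> tau_box s \<beta> x y"
    unfolding tau_box_def using assms lattice_box_mono[OF assms(4)]
    by (intro two_point_mono finite_lattice_box box_edges_mono box_edges_subset_Pow) auto
  finally show ?thesis .
qed

lemma tau_box_tendsto_tau:
  assumes "0 \<le> \<beta>"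
  shows "(\<lambda>r. tau_box r \<beta> x y) \<longlonglongrightarrow> tau \<beta> x (y :: int ^ 'd::finite)"
proof -
  \<comment> \<open>Spins outside the box have the value \<open>undefined\<close>, so monotonicity
    and boundedness are used only from an index on at which both points lie inside.\<close>
  obtain m :: nat where m: "2 * real_of_int (max (sup_norm x) (sup_norm y)) < real m"
    using reals_Archimedean2 by blast
  have box: "x \<in> lattice_box (r + m)" "y \<in> lattice_box (r + m)" for r
    using m by (auto intro!: sup_norm_less_in_lattice_box)
  have "incseq (\<lambda>r. tau_box (r + m) \<beta> x y)"
    using box assms by (intro incseq_SucI tau_box_mono) auto
  moreover have "Bseq (\<lambda>r. tau_box (r + m) \<beta> x y)"
    using box by (intro BseqI'[where K = 1])
      (auto simp: tau_box_def intro!: abs_two_point_le_1 finite_lattice_box)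
  ultimately have "convergent (\<lambda>r. tau_box (r + m) \<beta> x y)"
    by (intro Bseq_monoseq_convergent incseq_imp_monoseq)
  then have "convergent (\<lambda>r. tau_box r \<beta> x y)"
    using convergent_ignore_initial_segment[of "\<lambda>r. tau_box r \<beta> x y" m] by simp
  then show ?thesis
    unfolding tau_def by (simp add: convergent_LIMSEQ_iff)
qed

section \<open>The torus plateau\<close>

theorem corollary1p2:
  fixes \<beta>\<^sub>c c\<^sub>0 C\<^sub>0 c\<^sub>1 c\<^sub>2 c\<^sub>3 c\<^sub>4 c\<^sub>5 :: real
    and \<beta>_star :: "nat \<Rightarrow> real"
  assumes dim: "CARD('d::finite) > 4"
    and beta_c: "beta_crit TYPE('d) = ereal \<beta>\<^sub>c"
    and chi_bounds: "\<exists>k>0. \<exists>K>0. \<forall>\<beta>. 0 < \<beta> \<and> \<beta> < \<beta>\<^sub>c \<longrightarrow>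
          ennreal (k / (\<beta>\<^sub>c - \<beta>)) \<le> chi TYPE('d) \<beta> \<and>
          chi TYPE('d) \<beta> \<le> ennreal (K / (\<beta>\<^sub>c - \<beta>))"
    and pos: "c\<^sub>0 > 0" "C\<^sub>0 > 0" "c\<^sub>1 > 0" "c\<^sub>2 > 0" "c\<^sub>3 > 0" "c\<^sub>4 > 0" "c\<^sub>5 > 0"
    and tau_upper: "\<forall>\<beta>. \<forall>x :: int ^ 'd. 0 < \<beta> \<and> \<beta> \<le> \<beta>\<^sub>c \<longrightarrow>
          tau \<beta> 0 x \<le> C\<^sub>0 / max 1 (real_of_int (sup_norm x)) ^ (CARD('d) - 2)
            * exp (- c\<^sub>0 * (\<beta>\<^sub>c - \<beta>) powr (1/2) * real_of_int (sup_norm x))"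
    and tau_lower: "\<forall>\<beta>. \<forall>x :: int ^ 'd. 0 < \<beta> \<and> \<beta> \<le> \<beta>\<^sub>c \<and>
          (\<beta> = \<beta>\<^sub>c \<or> real_of_int (sup_norm x) \<le> c\<^sub>0 * (\<beta>\<^sub>c - \<beta>) powr (- 1/2)) \<longrightarrow>
          tau \<beta> 0 x \<ge> c\<^sub>0 / max 1 (real_of_int (sup_norm x)) ^ (CARD('d) - 2)"
    and c3: "c\<^sub>3 = 4/9 * c\<^sub>0 ^ 2"
    and torus_upper: "\<forall>r\<ge>3. \<forall>\<beta>. \<forall>x :: int ^ 'd. 0 < \<beta> \<and> \<beta> < \<beta>\<^sub>c \<and> x \<in> lattice_box r \<longrightarrow>
          tau_torus r \<beta> 0 x \<le> tau \<beta> 0 x + c\<^sub>1 * enn2real (chi TYPE('d) \<beta>) / real r ^ CARD('d)"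
    and torus_lower: "\<forall>r\<ge>3. \<forall>\<beta>. \<forall>x :: int ^ 'd. 0 < \<beta> \<and>
          \<beta>\<^sub>c - c\<^sub>3 / real r ^ 2 \<le> \<beta> \<and> \<beta> \<le> \<beta>\<^sub>c - c\<^sub>4 * real r powr (- (real CARD('d) / 2)) \<and>
          x \<in> lattice_box r \<and> real_of_int (sup_norm x) \<ge> c\<^sub>5 \<longrightarrow>
          tau_torus r \<beta> 0 x \<ge> tau \<beta> 0 x + c\<^sub>2 * enn2real (chi TYPE('d) \<beta>) / real r ^ CARD('d)"
    and beta_star: "\<forall>r. \<beta>_star r = \<beta>\<^sub>c - c\<^sub>4 * real r powr (- (real CARD('d) / 2))"
  shows "\<exists>r\<^sub>0\<ge>3.
    (\<exists>a A. 0 < a \<and> a \<le> A \<and>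
      (\<forall>r\<ge>r\<^sub>0. \<forall>x \<in> (lattice_box r :: (int ^ 'd) set).
        a * (1 / max 1 (real_of_int (sup_norm x)) ^ (CARD('d) - 2)
             + 1 / real r powr (real CARD('d) / 2))
          \<le> tau_torus r (\<beta>_star r) 0 x \<and>
        tau_torus r (\<beta>_star r) 0 x
          \<le> A * (1 / max 1 (real_of_int (sup_norm x)) ^ (CARD('d) - 2)
             + 1 / real r powr (real CARD('d) / 2)))) \<and>
    (\<exists>a>0. \<forall>r\<ge>r\<^sub>0. \<forall>x \<in> (lattice_box r :: (int ^ 'd) set). \<forall>\<beta>\<ge>\<beta>_star r.
        tau_torus r \<beta> 0 x
          \<ge> a * (1 / max 1 (real_of_int (sup_norm x)) ^ (CARD('d) - 2)
             + 1 / real r powr (real CARD('d) / 2)))"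
proof -

  \<comment> \<open>Notation and positivity of the critical point\<close>
  let ?d = "CARD('d)"
  define M where "M x = max 1 (real_of_int (sup_norm x)) ^ (?d - 2)" for x :: "int ^ 'd"
  define q where "q r = real r powr (real ?d / 2)" for r :: nat
  have M: "0 < M x" for x
    by (simp add: M_def)
  obtain k K where kK: "0 < k" "0 < K" and chi: "\<And>\<beta>. 0 < \<beta> \<Longrightarrow> \<beta> < \<beta>\<^sub>c \<Longrightarrow>
      ennreal (k / (\<beta>\<^sub>c - \<beta>)) \<le> chi TYPE('d) \<beta> \<and> chi TYPE('d) \<beta> \<le> ennreal (K / (\<beta>\<^sub>c - \<beta>))"
    using chi_bounds by blast
  have "0 < \<beta>\<^sub>c"
  proof -
    \<comment> \<open>The supremum of the empty set is \<open>- \<infinity>\<close> in the extended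
      reals, whereas the critical point is real.\<close>
    have "{\<beta>. 0 < \<beta> \<and> chi TYPE('d) \<beta> < \<infinity>} \<noteq> {}"
    proof
      assume "{\<beta>. 0 < \<beta> \<and> chi TYPE('d) \<beta> < \<infinity>} = {}"
      then have "beta_crit TYPE('d) = - \<infinity>"
        unfolding beta_crit_def by (simp only: image_empty Sup_empty bot_ereal_def)
      then show False using beta_c by simp
    qed
    then obtain \<beta> where "0 < \<beta>" "chi TYPE('d) \<beta> < \<infinity>" by blast
    moreover from this have "ereal \<beta> \<le> beta_crit TYPE('d)"
      unfolding beta_crit_def by (intro SUP_upper) simp
    ultimately show ?thesis using beta_c by simp
  qed
  text \<open>At \<open>\<beta>\<^sub>1\<close> the infinite-volume lower bound already covers all \<open>x\<close> with norm at most \<open>c\<^sub>5\<close>.\<close>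
  define \<beta>\<^sub>1 where "\<beta>\<^sub>1 = max (\<beta>\<^sub>c / 2) (\<beta>\<^sub>c - (c\<^sub>0 / c\<^sub>5)\<^sup>2)"
  have \<beta>\<^sub>1: "0 < \<beta>\<^sub>1" "\<beta>\<^sub>1 < \<beta>\<^sub>c" "\<beta>\<^sub>c - \<beta>\<^sub>1 \<le> (c\<^sub>0 / c\<^sub>5)\<^sup>2"
    using \<open>0 < \<beta>\<^sub>c\<close> pos by (auto simp: \<beta>\<^sub>1_def)
  \<comment> \<open>The condition of lying within the correlation length, rephrased for a radius
    \<open>s\<close>. It is applied with \<open>s = c\<^sub>5\<close> at
    \<open>\<beta>\<^sub>1\<close> and with \<open>s = 3 / 2 * r\<close> at
    \<open>\<beta>_star r\<close>.\<close>
  have tau_lower': "c\<^sub>0 / M x \<le> tau \<beta> 0 x"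
    if "0 < \<beta>" "\<beta> < \<beta>\<^sub>c" "0 < s" "\<beta>\<^sub>c - \<beta> \<le> (c\<^sub>0 / s)\<^sup>2" "real_of_int (sup_norm x) \<le> s" for \<beta> s x
  proof -
    have "sqrt (\<beta>\<^sub>c - \<beta>) \<le> c\<^sub>0 / s"
      using that pos by (intro real_le_lsqrt) auto
    then have "s \<le> c\<^sub>0 / sqrt (\<beta>\<^sub>c - \<beta>)"
      using that by (simp add: field_simps)
    also have "\<dots> = c\<^sub>0 * (\<beta>\<^sub>c - \<beta>) powr (- 1/2)"
      using that powr_minus_divide[of "\<beta>\<^sub>c - \<beta>" "1/2"] by (simp add: powr_half_sqrt)
    finally show ?thesis
      using tau_lower that unfolding M_def by (metis less_imp_le order_trans)
  qed

  \<comment> \<open>The finitely many points near the origin\<close>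
  define X where "X = {x :: int ^ 'd. real_of_int (sup_norm x) < c\<^sub>5}"
  obtain m :: nat where m: "2 * c\<^sub>5 < real m"
    using reals_Archimedean2 by blast
  have X_box: "x \<in> lattice_box m" if "x \<in> X" for x
    using that m unfolding X_def by (intro sup_norm_less_in_lattice_box) auto
  then have "X \<subseteq> lattice_box m" by blast
  then have "finite X"
    by (rule finite_subset) (rule finite_lattice_box)
  have "eventually (\<lambda>r. c\<^sub>0 / 2 / M x \<le> tau_box r \<beta>\<^sub>1 0 x) sequentially" if "x \<in> X" for x
  proof -
    have "c\<^sub>0 / M x \<le> tau \<beta>\<^sub>1 0 x"
      using that \<beta>\<^sub>1 pos unfolding X_def by (intro tau_lower'[of _ c\<^sub>5]) auto
    moreover have "c\<^sub>0 / 2 / M x < c\<^sub>0 / M x"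
      using pos M[of x] by (simp add: field_simps)
    ultimately have "c\<^sub>0 / 2 / M x < tau \<beta>\<^sub>1 0 x" by linarith
    then have "eventually (\<lambda>r. c\<^sub>0 / 2 / M x < tau_box r \<beta>\<^sub>1 0 x) sequentially"
      using \<beta>\<^sub>1 by (intro order_tendstoD(1)[OF tau_box_tendsto_tau]) auto
    then show ?thesis
      by eventually_elim simp
  qed
  \<comment> \<open>Finiteness of \<open>X\<close> makes the threshold for \<open>r\<close> uniform
    over its points.\<close>
  then have box: "eventually (\<lambda>r. \<forall>x\<in>X. c\<^sub>0 / 2 / M x \<le> tau_box r \<beta>\<^sub>1 0 x) sequentially"
    using \<open>finite X\<close> by (intro eventually_ball_finite) auto

  \<comment> \<open>Choice of \<open>r\<^sub>0\<close>\<close>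
  have q_0: "((\<lambda>r. real r powr - (real ?d / 2)) \<longlongrightarrow> 0) sequentially"
    using dim by (intro tendsto_neg_powr filterlim_real_sequentially) auto
  have "((\<lambda>r. c\<^sub>4 * real r powr - (real ?d / 2)) \<longlongrightarrow> 0) sequentially"
    using tendsto_mult_left[OF q_0, of c\<^sub>4] by simp
  then have ev_beta: "eventually (\<lambda>r. c\<^sub>4 * real r powr - (real ?d / 2) < \<beta>\<^sub>c - \<beta>\<^sub>1) sequentially"
    using \<beta>\<^sub>1 by (intro order_tendstoD(2)) auto
  \<comment> \<open>For points of \<open>X\<close> this makes the plateau term at most
    \<open>1 / M x\<close>.\<close>
  have ev_q: "eventually (\<lambda>r. real r powr - (real ?d / 2) < 1 / max 1 c\<^sub>5 ^ (?d - 2)) sequentially"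
    by (rule order_tendstoD(2)[OF q_0]) simp
  \<comment> \<open>The exponent is positive because d > 4. The quantity is r^2 / r^(d/2); once it
    is small, \<open>\<beta>_star r\<close> lies in the window of width
    \<open>c\<^sub>3 / r ^ 2\<close> where the torus lower bound holds.\<close>
  have "((\<lambda>r. real r powr - (real ?d / 2 - 2)) \<longlongrightarrow> 0) sequentially"
    using dim by (intro tendsto_neg_powr filterlim_real_sequentially) auto
  then have ev_r2: "eventually (\<lambda>r. real r powr - (real ?d / 2 - 2) < c\<^sub>3 / c\<^sub>4) sequentially"
    using pos by (intro order_tendstoD(2)) auto
  obtain r\<^sub>0 where r\<^sub>0: "\<And>r. r \<ge> r\<^sub>0 \<Longrightarrow> 3 \<le> r \<and> m \<le> r \<and>
      (\<forall>x\<in>X. c\<^sub>0 / 2 / M x \<le> tau_box r \<beta>\<^sub>1 0 x) \<and>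
      c\<^sub>4 * real r powr - (real ?d / 2) < \<beta>\<^sub>c - \<beta>\<^sub>1 \<and>
      real r powr - (real ?d / 2) < 1 / max 1 c\<^sub>5 ^ (?d - 2) \<and>
      real r powr - (real ?d / 2 - 2) < c\<^sub>3 / c\<^sub>4"
    using eventually_conj[OF eventually_ge_at_top[of 3] eventually_conj[OF eventually_ge_at_top[of m]
        eventually_conj[OF box eventually_conj[OF ev_beta eventually_conj[OF ev_q ev_r2]]]]]
    unfolding eventually_sequentially by blast
  \<comment> \<open>For points of \<open>X\<close> the box bound is
    \<open>c\<^sub>0 / 2 / M x\<close> and the bracket is at most \<open>2 / M x\<close>, whence
    \<open>c\<^sub>0 / 4\<close>. The second entry comes from the plateau term. In \<open>A\<close>,
    the entry \<open>a\<close> ensures \<open>a \<le> A\<close>.\<close>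
  define a where "a = min (c\<^sub>0 / 4) (c\<^sub>2 * k / c\<^sub>4)"
  define A where "A = max a (max C\<^sub>0 (c\<^sub>1 * K / c\<^sub>4))"
  have "0 < a" using pos kK by (simp add: a_def)
  have a_le: "a \<le> c\<^sub>0 / 4" "a \<le> c\<^sub>2 * k / c\<^sub>4"
    unfolding a_def by (rule min.cobounded1, rule min.cobounded2)
  \<comment> \<open>The inequality for \<open>\<beta>\<^sub>1\<close> is carried along to give
    positivity of \<open>\<beta>_star r\<close> in the final monotonicity step.\<close>
  have bounds: "\<beta>\<^sub>1 < \<beta>_star r \<and> a * (1 / M x + 1 / q r) \<le> tau_torus r (\<beta>_star r) 0 x \<and>
      tau_torus r (\<beta>_star r) 0 x \<le> A * (1 / M x + 1 / q r)"
    if r: "r \<ge> r\<^sub>0" and x: "x \<in> lattice_box r" for r x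
  proof -
    let ?b = "\<beta>_star r" and ?N = "real_of_int (sup_norm x)"
    have r3: "3 \<le> r" using r\<^sub>0[OF r] by simp
    \<comment> \<open>The susceptibility at \<open>\<beta>_star r\<close> has order
      \<open>q r\<close>, and the volume is the square of \<open>q r\<close>; their quotient has
      order \<open>1 / q r\<close>.\<close>
    have q: "0 < q r" and q_sq: "real r ^ ?d = q r * q r"
      using r3 by (simp_all add: q_def powr_realpow flip: powr_add)
    have powr_q: "real r powr - (real ?d / 2) = 1 / q r"
      by (simp add: q_def powr_minus_divide)
    have b: "\<beta>\<^sub>c - ?b = c\<^sub>4 / q r"
      using beta_star powr_q by simp
    have b1: "\<beta>\<^sub>1 < ?b"
      using r\<^sub>0[OF r] b powr_q by simp
    then have b_pos: "0 < ?b" using \<beta>\<^sub>1 by simp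
    have "0 < c\<^sub>4 / q r" using pos q by simp
    then have b_less: "?b < \<beta>\<^sub>c" using b by linarith
    have "real r powr - (real ?d / 2 - 2) = real r ^ 2 / q r"
      using r3 powr_diff[of "real r" 2 "real ?d / 2"] by (simp add: q_def)
    then have "real r ^ 2 / q r < c\<^sub>3 / c\<^sub>4"
      using r\<^sub>0[OF r] by simp
    then have gap: "c\<^sub>4 / q r \<le> c\<^sub>3 / real r ^ 2"
      using pos q r3 by (simp add: field_simps)
    have chi_upper: "enn2real (chi TYPE('d) ?b) \<le> K / (c\<^sub>4 / q r)"
      using enn2real_mono[OF conjunct2[OF chi[OF b_pos b_less]]] pos kK q by (simp add: b)
    \<comment> \<open>Since \<open>enn2real\<close> sends infinity to 0, it preserves the lower
      bound only for a finite susceptibility.\<close>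
    have "chi TYPE('d) ?b < top"
      using chi[OF b_pos b_less] by (meson ennreal_less_top le_less_trans)
    then have chi_lower: "k / (c\<^sub>4 / q r) \<le> enn2real (chi TYPE('d) ?b)"
      using enn2real_mono[OF conjunct1[OF chi[OF b_pos b_less]]] pos kK q by (simp add: b)

    \<comment> \<open>Lower bound at \<open>\<beta>_star r\<close>\<close>
    have lower: "a * (1 / M x + 1 / q r) \<le> tau_torus r ?b 0 x"
    proof (cases "?N < c\<^sub>5")
      case True
      then have "x \<in> X" by (simp add: X_def)
      have "M x \<le> max 1 c\<^sub>5 ^ (?d - 2)"
        using True unfolding M_def by (intro power_mono) auto
      then have "1 / max 1 c\<^sub>5 ^ (?d - 2) \<le> 1 / M x"
        using M[of x] by (intro divide_left_mono) auto
      then have "1 / q r \<le> 1 / M x"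
        using r\<^sub>0[OF r] powr_q by simp
      then have "a * (1 / M x + 1 / q r) \<le> (c\<^sub>0 / 4) * (1 / M x + 1 / M x)"
        using pos M[of x] q a_le(1) by (intro mult_mono) auto
      also have "\<dots> = c\<^sub>0 / 2 / M x" by simp
      also have "\<dots> \<le> tau_box r \<beta>\<^sub>1 0 x"
        using r\<^sub>0[OF r] \<open>x \<in> X\<close> by blast
      also have "\<dots> \<le> tau_torus r ?b 0 x"
        using r3 x \<beta>\<^sub>1 b1 by (intro tau_box_le_tau_torus zero_in_lattice_box) auto
      finally show ?thesis .
    next
      case False
      \<comment> \<open>The value \<open>c\<^sub>3 = 4/9 * c\<^sub>0 ^ 2\<close> corresponds to the
        radius \<open>3 / 2 * r\<close>, which exceeds the largest norm \<open>r / 2\<close> in the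
        box.\<close>
      have "c\<^sub>3 / real r ^ 2 = (c\<^sub>0 / (3 / 2 * real r))\<^sup>2"
        by (simp add: c3 power_divide power_mult_distrib)
      then have "c\<^sub>0 / M x \<le> tau ?b 0 x"
        using b gap b_pos b_less r3 sup_norm_lattice_box[OF x]
        by (intro tau_lower'[of _ "3 / 2 * real r"]) auto
      moreover have "c\<^sub>2 * k / c\<^sub>4 / q r \<le> c\<^sub>2 * enn2real (chi TYPE('d) ?b) / real r ^ ?d"
      proof -
        have "c\<^sub>2 * k / c\<^sub>4 / q r = c\<^sub>2 * (k / (c\<^sub>4 / q r)) / real r ^ ?d"
          using q pos by (simp add: q_sq)
        also have "\<dots> \<le> c\<^sub>2 * enn2real (chi TYPE('d) ?b) / real r ^ ?d"
          using chi_lower pos by (intro divide_right_mono mult_left_mono) auto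
        finally show ?thesis .
      qed
      moreover have "tau ?b 0 x + c\<^sub>2 * enn2real (chi TYPE('d) ?b) / real r ^ ?d \<le> tau_torus r ?b 0 x"
      proof -
        have "\<beta>\<^sub>c - c\<^sub>3 / real r ^ 2 \<le> ?b"
          using gap b by linarith
        moreover have "?b \<le> \<beta>\<^sub>c - c\<^sub>4 * real r powr (- (real ?d / 2))"
          using beta_star by simp
        ultimately show ?thesis
          using torus_lower r3 b_pos x False by simp
      qed
      ultimately have "c\<^sub>0 / M x + c\<^sub>2 * k / c\<^sub>4 / q r \<le> tau_torus r ?b 0 x" by linarith
      moreover have "a / M x \<le> c\<^sub>0 / M x"
        using M[of x] pos a_le(1) by (intro divide_right_mono) auto
      moreover have "a / q r \<le> c\<^sub>2 * k / c\<^sub>4 / q r"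
        using q a_le(2) by (intro divide_right_mono) auto
      ultimately show ?thesis by (simp add: ring_distribs)
    qed

    \<comment> \<open>Upper bound at \<open>\<beta>_star r\<close>\<close>
    have "tau_torus r ?b 0 x \<le> tau ?b 0 x + c\<^sub>1 * enn2real (chi TYPE('d) ?b) / real r ^ ?d"
      using torus_upper r3 b_pos b_less x by blast
    moreover have "tau ?b 0 x \<le> A / M x"
    proof -
      have "tau ?b 0 x \<le> C\<^sub>0 / M x * exp (- c\<^sub>0 * (\<beta>\<^sub>c - ?b) powr (1/2) * ?N)"
        using tau_upper b_pos b_less unfolding M_def by auto
      also have "\<dots> \<le> C\<^sub>0 / M x * 1"
        using pos M[of x] sup_norm_nonneg[of x] by (intro mult_left_mono) auto
      also have "\<dots> \<le> A / M x"
        using M[of x] by (auto simp: A_def intro!: divide_right_mono)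
      finally show ?thesis .
    qed
    moreover have "c\<^sub>1 * enn2real (chi TYPE('d) ?b) / real r ^ ?d \<le> A / q r"
    proof -
      have "c\<^sub>1 * enn2real (chi TYPE('d) ?b) / real r ^ ?d \<le> c\<^sub>1 * (K / (c\<^sub>4 / q r)) / real r ^ ?d"
        using chi_upper pos by (intro divide_right_mono mult_left_mono) auto
      also have "\<dots> = c\<^sub>1 * K / c\<^sub>4 / q r"
        using q pos by (simp add: q_sq)
      also have "\<dots> \<le> A / q r"
        using q by (intro divide_right_mono) (auto simp: A_def)
      finally show ?thesis .
    qed
    ultimately have "tau_torus r ?b 0 x \<le> A * (1 / M x + 1 / q r)"
      by (simp add: ring_distribs)
    with lower b1 show ?thesis by blast
  qed

  \<comment> \<open>Extension to all larger \<beta>\<close>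
  have "a * (1 / M x + 1 / q r) \<le> tau_torus r \<beta> 0 x"
    if "r \<ge> r\<^sub>0" "x \<in> lattice_box r" "\<beta> \<ge> \<beta>_star r" for r x \<beta>
  proof -
    have "tau_torus r (\<beta>_star r) 0 x \<le> tau_torus r \<beta> 0 x"
      using bounds[OF that(1,2)] that r\<^sub>0[OF that(1)] \<beta>\<^sub>1
      by (intro tau_torus_mono zero_in_lattice_box) auto
    then show ?thesis using bounds[OF that(1,2)] by linarith
  qed
  moreover have "3 \<le> r\<^sub>0" using r\<^sub>0[of r\<^sub>0] by simp
  moreover have "a \<le> A" by (simp add: A_def)
  ultimately show ?thesis
    using bounds \<open>0 < a\<close> unfolding M_def q_def by (intro exI[of _ r\<^sub>0]) blast
qed

end
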